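(* The category of spatial fuzzy topological systems (the full subcategory of $\mathbf{[0,1]}$-$\mathbf{TopSys}$ on the spatial objects) is equivalent to the category $\mathbf{[0,1]}$-$\mathbf{Top}$ of fuzzy topological spaces.
   Context: A frame is a poset with arbitrary joins and finite meets (including the empty ones) in which binary meets distribute over arbitrary joins; a frame homomorphism preserves arbitrary joins and finite meets. $\mathbf{[0,1]}$-$\mathbf{Top}$: objects are fuzzy topological spaces $(X,\tau)$, where $X$ is a set and $\tau$ is a collection of maps $X\to[0,1]$ containing the constants $0$ and $1$ and closed under arbitrary pointwise suprema and binary pointwise minima. A morphism $(X,\tau_1)\to(Y,\tau_2)$ is a function $f:X\to Y$ such that $\tilde B\circ f\in\tau_1$ for every $\tilde B\in\tau_2$. $\mathbf{[0,1]}$-$\mathbf{TopSys}$: objects are fuzzy topological systems $(X,\models,A)$, where $X$ is a non-empty set, $A$ is a frame and $\models$ is a function $(x,a)\mapsto gr(x\models a)\in[0,1]$ on $X\times A$ such that $gr(x\models\bigwedge S)=\inf\{gr(x\models s): s\in S\}$ for every finite $S\subseteq A$ and $gr(x\models\bigvee S)=\sup\{gr(x\models s): s\in S\}$ for every $S\subseteq A$ (with $\inf\emptyset=1$, $\sup\emptyset=0$). A morphism $(X,\models,A)\to(Y,\models',B)$ is a pair $(f_1,f_2)$ with $f_1:X\to Y$ a function and $f_2:B\to A$ a frame homomorphism such that $gr(x\models f_2(b))=gr(f_1(x)\models' b)$ for all $x\in X$, $b\in B$. Composition is $(g_1,g_2)\circ(f_1,f_2)=(g_1\circ f_1,f_2\circ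 g_2)$. A fuzzy topological system $(X,\models,A)$ is spatial if for all $a,b\in A$: whenever $gr(x\models a)=gr(x\models b)$ for all $x\in X$, then $a=b$.
   Formalization: Fuzzy topological spaces are taken on non-empty sets only, as for systems: with the empty space, [0,1]-Top has an initial object and spatial systems have none. Sets range over a family of point sets and one of frame carriers large enough to hold a copy of every fuzzy topology. *)

theory Defs
  imports Complex_Main "HOL-Library.FuncSet" "HOL-Library.Equipollence" "HOL-Algebra.Lattice"
begin

section \<open>Categories, functors, equivalence\<close>

text \<open>
  Hom-sets are indexed by pairs of objects and need not be disjoint; accordingly composition takes
  the three objects involved as arguments: \<open>cmp C a b c g f\<close> is the composite
  of \<open>f : a \<rightarrow> b\<close> followed by \<open>g : b \<rightarrow> c\<close>.
\<close>

record ('o, 'm) cat =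
  obj :: "'o set"
  hom :: "'o \<Rightarrow> 'o \<Rightarrow> 'm set"
  ide :: "'o \<Rightarrow> 'm"
  cmp :: "'o \<Rightarrow> 'o \<Rightarrow> 'o \<Rightarrow> 'm \<Rightarrow> 'm \<Rightarrow> 'm"

locale category =
  fixes C :: "('o, 'm) cat"
  assumes ide_in_hom: "a \<in> obj C \<Longrightarrow> ide C a \<in> hom C a a"
    and cmp_in_hom: "\<lbrakk>a \<in> obj C; b \<in> obj C; c \<in> obj C; f \<in> hom C a b; g \<in> hom C b c\<rbrakk>
      \<Longrightarrow> cmp C a b c g f \<in> hom C a c"
    and cmp_ide_left: "\<lbrakk>a \<in> obj C; b \<in> obj C; f \<in> hom C a b\<rbrakk> \<Longrightarrow> cmp C a b b (ide C b) f = f"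
    and cmp_ide_right: "\<lbrakk>a \<in> obj C; b \<in> obj C; f \<in> hom C a b\<rbrakk> \<Longrightarrow> cmp C a a b f (ide C a) = f"
    and cmp_assoc: "\<lbrakk>a \<in> obj C; b \<in> obj C; c \<in> obj C; d \<in> obj C;
        f \<in> hom C a b; g \<in> hom C b c; h \<in> hom C c d\<rbrakk>
      \<Longrightarrow> cmp C a c d h (cmp C a b c g f) = cmp C a b d (cmp C b c d h g) f"

definition full_subcategory :: "('o, 'm) cat \<Rightarrow> ('o \<Rightarrow> bool) \<Rightarrow> ('o, 'm) cat" where
  "full_subcategory C P = C\<lparr>obj := {a \<in> obj C. P a}\<rparr>"

definition isomorphism :: "('o, 'm) cat \<Rightarrow> 'o \<Rightarrow> 'o \<Rightarrow> 'm \<Rightarrow> bool" where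
  "isomorphism C a b f \<longleftrightarrow> f \<in> hom C a b \<and>
    (\<exists>g \<in> hom C b a. cmp C a b a g f = ide C a \<and> cmp C b a b f g = ide C b)"

record ('o, 'm, 'p, 'n) fctr =
  on_obj :: "'o \<Rightarrow> 'p"
  on_hom :: "'o \<Rightarrow> 'o \<Rightarrow> 'm \<Rightarrow> 'n"

locale cat_functor = C: category C + D: category D
  for C :: "('o, 'm) cat" and D :: "('p, 'n) cat" +
  fixes F :: "('o, 'm, 'p, 'n) fctr"
  assumes on_obj_in_obj: "a \<in> obj C \<Longrightarrow> on_obj F a \<in> obj D"
    and on_hom_in_hom: "\<lbrakk>a \<in> obj C; b \<in> obj C; f \<in> hom C a b\<rbrakk>
      \<Longrightarrow> on_hom F a b f \<in> hom D (on_obj F a) (on_obj F b)"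
    and on_hom_ide: "a \<in> obj C \<Longrightarrow> on_hom F a a (ide C a) = ide D (on_obj F a)"
    and on_hom_cmp: "\<lbrakk>a \<in> obj C; b \<in> obj C; c \<in> obj C; f \<in> hom C a b; g \<in> hom C b c\<rbrakk>
      \<Longrightarrow> on_hom F a c (cmp C a b c g f)
        = cmp D (on_obj F a) (on_obj F b) (on_obj F c) (on_hom F b c g) (on_hom F a b f)"

definition id_functor :: "('o, 'm, 'o, 'm) fctr" where
  "id_functor = \<lparr>on_obj = (\<lambda>a. a), on_hom = (\<lambda>a b f. f)\<rparr>"

definition comp_functor ::
  "('p, 'n, 'q, 'k) fctr \<Rightarrow> ('o, 'm, 'p, 'n) fctr \<Rightarrow> ('o, 'm, 'q, 'k) fctr" where
  "comp_functor G F = \<lparr>on_obj = (\<lambda>a. on_obj G (on_obj F a)),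
     on_hom = (\<lambda>a b f. on_hom G (on_obj F a) (on_obj F b) (on_hom F a b f))\<rparr>"

locale natural_isomorphism = F: cat_functor C D F + G: cat_functor C D G
  for C :: "('o, 'm) cat" and D :: "('p, 'n) cat" and F G :: "('o, 'm, 'p, 'n) fctr" +
  fixes \<eta> :: "'o \<Rightarrow> 'n"
  assumes component: "a \<in> obj C \<Longrightarrow> isomorphism D (on_obj F a) (on_obj G a) (\<eta> a)"
    and naturality: "\<lbrakk>a \<in> obj C; b \<in> obj C; f \<in> hom C a b\<rbrakk>
      \<Longrightarrow> cmp D (on_obj F a) (on_obj F b) (on_obj G b) (\<eta> b) (on_hom F a b f)
        = cmp D (on_obj F a) (on_obj G a) (on_obj G b) (on_hom G a b f) (\<eta> a)"

definition equivalent_categories :: "('o, 'm) cat \<Rightarrow> ('p, 'n) cat \<Rightarrow> bool" where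
  "equivalent_categories C D \<longleftrightarrow> category C \<and> category D \<and>
    (\<exists>F G \<eta> \<epsilon>. cat_functor C D F \<and> cat_functor D C G \<and>
      natural_isomorphism C C id_functor (comp_functor G F) \<eta> \<and>
      natural_isomorphism D D (comp_functor F G) id_functor \<epsilon>)"

section \<open>Frames\<close>

locale frame = partial_order L for L (structure) +
  assumes joins_exist: "S \<subseteq> carrier L \<Longrightarrow> \<exists>s. is_lub L s S"
    and finite_meets_exist: "\<lbrakk>finite S; S \<subseteq> carrier L\<rbrakk> \<Longrightarrow> \<exists>s. is_glb L s S"
    and meet_join_distrib: "\<lbrakk>x \<in> carrier L; S \<subseteq> carrier L\<rbrakk>
      \<Longrightarrow> x \<sqinter> \<Squnion>S = \<Squnion>((\<lambda>s. x \<sqinter> s) ` S)"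

definition frame_hom :: "'a gorder \<Rightarrow> 'b gorder \<Rightarrow> ('a \<Rightarrow> 'b) \<Rightarrow> bool" where
  "frame_hom A B f \<longleftrightarrow> f \<in> carrier A \<rightarrow> carrier B \<and>
    (\<forall>S \<subseteq> carrier A. f (\<Squnion>\<^bsub>A\<^esub>S) = \<Squnion>\<^bsub>B\<^esub>(f ` S)) \<and>
    (\<forall>S \<subseteq> carrier A. finite S \<longrightarrow> f (\<Sqinter>\<^bsub>A\<^esub>S) = \<Sqinter>\<^bsub>B\<^esub>(f ` S))"

section \<open>Fuzzy topological spaces\<close>

text \<open>
  Suprema and infima in the complete lattice \<open>[0,1]\<close>. On \<^typ>\<open>real\<close>, \<open>Sup {}\<close> and \<open>Inf {}\<close> are
  unspecified; inserting the bound changes nothing for non-empty subsets of \<open>[0,1]\<close> and gives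
  \<open>sup {} = 0\<close> and \<open>inf {} = 1\<close>.
\<close>

definition unit_Sup :: "real set \<Rightarrow> real" where
  "unit_Sup S = Sup (insert 0 S)"

definition unit_Inf :: "real set \<Rightarrow> real" where
  "unit_Inf S = Inf (insert 1 S)"

record 'x fuzzy_space =
  space_points :: "'x set"
  fuzzy_opens :: "('x \<Rightarrow> real) set"

text \<open>
  Maps out of a set \<open>X\<close> are represented by extensional functions, so that two maps are equal iff
  they agree on \<open>X\<close>.
\<close>

definition fuzzy_topological_space :: "'x fuzzy_space \<Rightarrow> bool" where
  "fuzzy_topological_space T \<longleftrightarrow>
    (let X = space_points T; \<tau> = fuzzy_opens T in
      \<tau> \<subseteq> X \<rightarrow>\<^sub>E {0..1} \<and>
      (\<lambda>x\<in>X. 0) \<in> \<tau> \<and> (\<lambda>x\<in>X. 1) \<in> \<tau> \<and>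
      (\<forall>S \<subseteq> \<tau>. (\<lambda>x\<in>X. unit_Sup ((\<lambda>B. B x) ` S)) \<in> \<tau>) \<and>
      (\<forall>B \<in> \<tau>. \<forall>C \<in> \<tau>. (\<lambda>x\<in>X. min (B x) (C x)) \<in> \<tau>))"

definition fuzzy_continuous :: "'x fuzzy_space \<Rightarrow> 'x fuzzy_space \<Rightarrow> ('x \<Rightarrow> 'x) \<Rightarrow> bool" where
  "fuzzy_continuous S T f \<longleftrightarrow> f \<in> space_points S \<rightarrow>\<^sub>E space_points T \<and>
    (\<forall>B \<in> fuzzy_opens T. compose (space_points S) B f \<in> fuzzy_opens S)"

text \<open>
  A HOL type does not contain all sets, so the categories below are taken relative to a family
  \<open>PS\<close> of admissible point sets and a family \<open>FS\<close> of admissible carriers of frames. The small sets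
  of a Grothendieck universe can be chosen for both; another choice is all sets of a given type.
\<close>

definition fuzzy_Top :: "'x set set \<Rightarrow> ('x fuzzy_space, 'x \<Rightarrow> 'x) cat" where
  "fuzzy_Top PS = \<lparr>
     obj = {T. space_points T \<in> PS \<and> fuzzy_topological_space T},
     hom = (\<lambda>S T. {f. fuzzy_continuous S T f}),
     ide = (\<lambda>T. \<lambda>x\<in>space_points T. x),
     cmp = (\<lambda>R S T g f. compose (space_points R) g f)\<rparr>"

section \<open>Fuzzy topological systems\<close>

record ('x, 'a) fuzzy_system =
  sys_points :: "'x set"
  gr :: "'x \<Rightarrow> 'a \<Rightarrow> real"
  sys_frame :: "'a gorder"

definition fuzzy_topological_system :: "('x, 'a) fuzzy_system \<Rightarrow> bool" where
  "fuzzy_topological_system D \<longleftrightarrow>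
    (let X = sys_points D; A = sys_frame D in
      X \<noteq> {} \<and> frame A \<and>
      (\<forall>x \<in> X. \<forall>a \<in> carrier A. gr D x a \<in> {0..1}) \<and>
      (\<forall>x \<in> X. \<forall>S \<subseteq> carrier A. finite S \<longrightarrow> gr D x (\<Sqinter>\<^bsub>A\<^esub>S) = unit_Inf (gr D x ` S)) \<and>
      (\<forall>x \<in> X. \<forall>S \<subseteq> carrier A. gr D x (\<Squnion>\<^bsub>A\<^esub>S) = unit_Sup (gr D x ` S)))"

definition system_morphism ::
  "('x, 'a) fuzzy_system \<Rightarrow> ('x, 'a) fuzzy_system \<Rightarrow> ('x \<Rightarrow> 'x) \<times> ('a \<Rightarrow> 'a) \<Rightarrow> bool" where
  "system_morphism D E f \<longleftrightarrow>
    fst f \<in> sys_points D \<rightarrow>\<^sub>E sys_points E \<and>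
    snd f \<in> carrier (sys_frame E) \<rightarrow>\<^sub>E carrier (sys_frame D) \<and>
    frame_hom (sys_frame E) (sys_frame D) (snd f) \<and>
    (\<forall>x \<in> sys_points D. \<forall>b \<in> carrier (sys_frame E). gr D x (snd f b) = gr E (fst f x) b)"

definition fuzzy_TopSys ::
  "'x set set \<Rightarrow> 'a set set \<Rightarrow> (('x, 'a) fuzzy_system, ('x \<Rightarrow> 'x) \<times> ('a \<Rightarrow> 'a)) cat" where
  "fuzzy_TopSys PS FS = \<lparr>
     obj = {D. sys_points D \<in> PS \<and> carrier (sys_frame D) \<in> FS \<and> fuzzy_topological_system D},
     hom = (\<lambda>D E. {f. system_morphism D E f}),
     ide = (\<lambda>D. (\<lambda>x\<in>sys_points D. x, \<lambda>a\<in>carrier (sys_frame D). a)),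
     cmp = (\<lambda>D E K g f. (compose (sys_points D) (fst g) (fst f),
                           compose (carrier (sys_frame K)) (snd f) (snd g)))\<rparr>"

definition spatial :: "('x, 'a) fuzzy_system \<Rightarrow> bool" where
  "spatial D \<longleftrightarrow> (\<forall>a \<in> carrier (sys_frame D). \<forall>b \<in> carrier (sys_frame D).
    (\<forall>x \<in> sys_points D. gr D x a = gr D x b) \<longrightarrow> a = b)"

text \<open>
  Systems have a non-empty point set by definition, whereas the definition of a fuzzy topological
  space admits the space on the empty set. That space is an initial object among all fuzzy spaces,
  while the non-empty ones have no initial object as soon as a point set with two elements is
  admissible. Spatial systems are therefore to be compared with the spaces on non-empty sets, i.e.
  with \<^term>\<open>fuzzy_Top PS\<close> for a family \<open>PS\<close> of non-empty sets.
\<close>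

end

theory Submission
  imports Defs
begin

text \<open>
  Each frame element \<open>a\<close> of a system has an extent, the fuzzy set \<open>x \<mapsto> gr(x \<Turnstile> a)\<close>. Since \<open>gr\<close> turns
  finite meets into infima and joins into suprema, the extents form a fuzzy topology, and sending a
  system to this space and a morphism \<open>(f\<^sub>1, f\<^sub>2)\<close> to \<open>f\<^sub>1\<close> is a functor. It suffices that, on spatial
  systems, this functor is full, faithful and surjective on objects
  (\<open>full_faithful_surjective_equivalence\<close>).

  Full and faithful: in a spatial system an element is determined by its extent. The compatibility
  condition says that the extent of \<open>f\<^sub>2 b\<close> is the extent of \<open>b\<close> composed with \<open>f\<^sub>1\<close>, so \<open>f\<^sub>1\<close> determines
  \<open>f\<^sub>2\<close> (\<open>system_morphism_eqI\<close>). Conversely, if \<open>f\<^sub>1\<close> is continuous, this composite is again an extent,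
  which defines \<open>f\<^sub>2\<close>; that it is a frame homomorphism then comes for free
  (\<open>frame_hom_if_gr_compatible\<close>), because both sides of each equation to be checked have the same
  extent.

  Surjective on objects: a fuzzy topology ordered pointwise is a frame, since finite infima and
  arbitrary suprema of opens are computed pointwise and distribute in \<open>[0,1]\<close>. Evaluation makes it
  a spatial system whose extents are the given opens. Frame carriers must lie in \<open>FS\<close>, so the
  frame is transported along a bijection between the topology and a member of \<open>FS\<close>
  (\<open>space_is_extent_space\<close>); the extents, hence the space, do not change.
\<close>

section \<open>Full and faithful functors that are surjective on objects\<close>

lemma cat_functor_id: "category C \<Longrightarrow> cat_functor C C id_functor"
  by (simp add: cat_functor_def cat_functor_axioms_def id_functor_def)

lemma cat_functor_comp:
  assumes F: "cat_functor C D F" and G: "cat_functor D E G"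
  shows "cat_functor C E (comp_functor G F)"
proof -
  interpret F: cat_functor C D F by (rule F)
  interpret G: cat_functor D E G by (rule G)
  show ?thesis
    by unfold_locales (simp_all add: comp_functor_def F.on_obj_in_obj F.on_hom_in_hom F.on_hom_ide
      F.on_hom_cmp G.on_obj_in_obj G.on_hom_in_hom G.on_hom_ide G.on_hom_cmp)
qed

text \<open>
  A right inverse \<open>s\<close> of the object map becomes a functor \<open>G\<close> by lifting morphisms through the
  bijections on hom-sets. Then \<open>F \<circ> G\<close> is the identity on the nose, and \<open>a\<close> is isomorphic to
  \<open>G (F a)\<close> because both have the same image under \<open>F\<close>: lift the identity of that image. Every equation
  in the source category is checked after applying the faithful \<open>F\<close>.
\<close>

lemma full_faithful_surjective_equivalence:
  assumes F: "cat_functor C D F"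
    and ff: "\<And>a b. a \<in> obj C \<Longrightarrow> b \<in> obj C \<Longrightarrow>
      bij_betw (on_hom F a b) (hom C a b) (hom D (on_obj F a) (on_obj F b))"
    and surj: "on_obj F ` obj C = obj D"
  shows "equivalent_categories C D"
proof -
  interpret F: cat_functor C D F by (rule F)
  define s where "s = inv_into (obj C) (on_obj F)"
  define lift where "lift a b = inv_into (hom C a b) (on_hom F a b)" for a b
  define G where "G = \<lparr>on_obj = s, on_hom = (\<lambda>a b. lift (s a) (s b))\<rparr>"
  define \<eta> where "\<eta> a = lift a (s (on_obj F a)) (ide D (on_obj F a))" for a
  have s_obj: "s b \<in> obj C" and F_s: "on_obj F (s b) = b" if "b \<in> obj D" for b
    using that surj unfolding s_def by (auto intro: inv_into_into f_inv_into_f)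
  have lift_hom: "lift a b h \<in> hom C a b" and F_lift: "on_hom F a b (lift a b h) = h"
    if "a \<in> obj C" "b \<in> obj C" "h \<in> hom D (on_obj F a) (on_obj F b)" for a b h
    using ff[OF that(1,2)] that(3) unfolding lift_def bij_betw_def
    by (auto intro: inv_into_into f_inv_into_f)
  have hom_eqI: "f = g" if "on_hom F a b f = on_hom F a b g"
    "a \<in> obj C" "b \<in> obj C" "f \<in> hom C a b" "g \<in> hom C a b" for a b f g
    using ff[OF that(2,3)] that unfolding bij_betw_def inj_on_def by blast
  note rules = F.on_obj_in_obj F.on_hom_in_hom F.on_hom_ide F.on_hom_cmp s_obj F_s lift_hom F_lift
    F.C.ide_in_hom F.C.cmp_in_hom F.D.ide_in_hom F.D.cmp_in_hom
    F.D.cmp_ide_left F.D.cmp_ide_right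
  have G: "cat_functor D C G"
  proof (unfold_locales, unfold G_def fctr.simps)
    show "s a \<in> obj C" if "a \<in> obj D" for a using that by (rule s_obj)
    show "lift (s a) (s b) f \<in> hom C (s a) (s b)"
      if "a \<in> obj D" "b \<in> obj D" "f \<in> hom D a b" for a b f
      using that by (simp add: rules)
    show "lift (s a) (s a) (ide D a) = ide C (s a)" if "a \<in> obj D" for a
      by (rule hom_eqI[of "s a" "s a"]) (use that in \<open>simp_all add: rules\<close>)
    show "lift (s a) (s c) (cmp D a b c g f)
        = cmp C (s a) (s b) (s c) (lift (s b) (s c) g) (lift (s a) (s b) f)"
      if "a \<in> obj D" "b \<in> obj D" "c \<in> obj D" "f \<in> hom D a b" "g \<in> hom D b c" for a b c f g
    proof (rule hom_eqI[of "s a" "s c"])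
      have *: "cmp D a b c g f \<in> hom D a c" using that F.D.cmp_in_hom by blast
      have fg: "lift (s b) (s c) g \<in> hom C (s b) (s c)" "lift (s a) (s b) f \<in> hom C (s a) (s b)"
        using that by (simp_all add: rules)
      show "on_hom F (s a) (s c) (lift (s a) (s c) (cmp D a b c g f)) = on_hom F (s a) (s c)
          (cmp C (s a) (s b) (s c) (lift (s b) (s c) g) (lift (s a) (s b) f))"
        using that * fg by (simp add: rules)
      show "lift (s a) (s c) (cmp D a b c g f) \<in> hom C (s a) (s c)" using that * by (simp add: rules)
      show "cmp C (s a) (s b) (s c) (lift (s b) (s c) g) (lift (s a) (s b) f) \<in> hom C (s a) (s c)"
        using that fg F.C.cmp_in_hom s_obj by blast
    qed (use that in \<open>simp_all add: rules\<close>)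
  qed
  have eta: "natural_isomorphism C C id_functor (comp_functor G F) \<eta>"
  proof (rule natural_isomorphism.intro[OF cat_functor_id[OF F.C.category_axioms]
        cat_functor_comp[OF F G] natural_isomorphism_axioms.intro],
      unfold G_def id_functor_def comp_functor_def fctr.simps)
    fix a assume a: "a \<in> obj C"
    let ?b = "s (on_obj F a)"
    let ?\<theta> = "lift ?b a (ide D (on_obj F a))"
    have b: "?b \<in> obj C" "on_obj F ?b = on_obj F a" using a by (simp_all add: rules)
    have \<eta>: "\<eta> a \<in> hom C a ?b" "on_hom F a ?b (\<eta> a) = ide D (on_obj F a)"
      using a b unfolding \<eta>_def by (simp_all add: rules)
    have \<theta>: "?\<theta> \<in> hom C ?b a" "on_hom F ?b a ?\<theta> = ide D (on_obj F a)"
      using a b by (simp_all add: rules)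
    have "cmp C a ?b a ?\<theta> (\<eta> a) = ide C a"
      by (rule hom_eqI[of a a]) (use a b \<eta> \<theta> F.C.cmp_in_hom in \<open>auto simp: rules\<close>)
    moreover have "cmp C ?b a ?b (\<eta> a) ?\<theta> = ide C ?b"
      by (rule hom_eqI[of ?b ?b]) (use a b \<eta> \<theta> F.C.cmp_in_hom in \<open>auto simp: rules\<close>)
    ultimately show "isomorphism C a ?b (\<eta> a)"
      unfolding isomorphism_def using \<eta> \<theta> by blast
  next
    fix a b f assume ab: "a \<in> obj C" "b \<in> obj C" and f: "f \<in> hom C a b"
    let ?a = "s (on_obj F a)" and ?b = "s (on_obj F b)"
    let ?f = "lift ?a ?b (on_hom F a b f)"
    have s: "?a \<in> obj C" "on_obj F ?a = on_obj F a" "?b \<in> obj C" "on_obj F ?b = on_obj F b"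
      using ab by (simp_all add: rules)
    have eta: "\<eta> a \<in> hom C a ?a" "on_hom F a ?a (\<eta> a) = ide D (on_obj F a)"
      "\<eta> b \<in> hom C b ?b" "on_hom F b ?b (\<eta> b) = ide D (on_obj F b)"
      using ab s unfolding \<eta>_def by (simp_all add: rules)
    have Ff: "on_hom F a b f \<in> hom D (on_obj F a) (on_obj F b)"
      using ab f by (rule F.on_hom_in_hom)
    have lf: "?f \<in> hom C ?a ?b" "on_hom F ?a ?b ?f = on_hom F a b f"
      using ab s Ff by (simp_all add: rules)
    show "cmp C a b ?b (\<eta> b) f = cmp C a ?a ?b ?f (\<eta> a)"
    proof (rule hom_eqI[of a ?b])
      show "on_hom F a ?b (cmp C a b ?b (\<eta> b) f) = on_hom F a ?b (cmp C a ?a ?b ?f (\<eta> a))"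
        using ab f s eta Ff lf by (simp add: rules)
      show "cmp C a b ?b (\<eta> b) f \<in> hom C a ?b" using ab f s eta F.C.cmp_in_hom by blast
      show "cmp C a ?a ?b ?f (\<eta> a) \<in> hom C a ?b" using ab lf s eta F.C.cmp_in_hom by blast
    qed (use ab s in simp_all)
  qed
  \<comment> \<open>The components are identities, because \<open>s\<close> is a strict right inverse on objects.\<close>
  have eps: "natural_isomorphism D D (comp_functor F G) id_functor (ide D)"
  proof (rule natural_isomorphism.intro[OF cat_functor_comp[OF G F]
        cat_functor_id[OF F.D.category_axioms] natural_isomorphism_axioms.intro],
      unfold G_def id_functor_def comp_functor_def fctr.simps)
    show "isomorphism D (on_obj F (s a)) a (ide D a)" if "a \<in> obj D" for a
      unfolding isomorphism_def using that by (auto simp: rules intro!: bexI[of _ "ide D a"])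
  qed (simp_all add: rules)
  show ?thesis
    unfolding equivalent_categories_def
    using F G eta eps F.C.category_axioms F.D.category_axioms by blast
qed

section \<open>Suprema and infima in the unit interval\<close>

lemma unit_Sup_upper: "S \<subseteq> {0..1} \<Longrightarrow> s \<in> S \<Longrightarrow> s \<le> unit_Sup S"
  unfolding unit_Sup_def by (rule cSup_upper) (auto intro!: bdd_aboveI[of _ 1])

lemma unit_Sup_least: "0 \<le> u \<Longrightarrow> (\<And>s. s \<in> S \<Longrightarrow> s \<le> u) \<Longrightarrow> unit_Sup S \<le> u"
  unfolding unit_Sup_def by (rule cSup_least) auto

lemma unit_Sup_nonneg: "S \<subseteq> {0..1} \<Longrightarrow> 0 \<le> unit_Sup S"
  unfolding unit_Sup_def by (rule cSup_upper) (auto intro!: bdd_aboveI[of _ 1])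

lemma unit_Sup_empty: "unit_Sup {} = 0"
  by (simp add: unit_Sup_def)

lemma unit_Inf_lower: "S \<subseteq> {0..1} \<Longrightarrow> s \<in> S \<Longrightarrow> unit_Inf S \<le> s"
  unfolding unit_Inf_def by (rule cInf_lower) (auto intro!: bdd_belowI[of _ 0])

lemma unit_Inf_greatest: "u \<le> 1 \<Longrightarrow> (\<And>s. s \<in> S \<Longrightarrow> u \<le> s) \<Longrightarrow> u \<le> unit_Inf S"
  unfolding unit_Inf_def by (rule cInf_greatest) auto

lemma unit_Inf_le_1: "S \<subseteq> {0..1} \<Longrightarrow> unit_Inf S \<le> 1"
  unfolding unit_Inf_def by (rule cInf_lower) (auto intro!: bdd_belowI[of _ 0])

lemma unit_Inf_empty: "unit_Inf {} = 1"
  by (simp add: unit_Inf_def)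

lemma unit_Inf_insert:
  assumes "a \<in> {0..1}" "S \<subseteq> {0..1}"
  shows "unit_Inf (insert a S) = min a (unit_Inf S)"
proof (rule antisym)
  show "unit_Inf (insert a S) \<le> min a (unit_Inf S)"
    using assms by (auto intro!: unit_Inf_lower unit_Inf_greatest unit_Inf_le_1)
  show "min a (unit_Inf S) \<le> unit_Inf (insert a S)"
    using assms unit_Inf_lower[OF assms(2)]
    by (intro unit_Inf_greatest) (auto simp: min_le_iff_disj)
qed

lemma unit_Inf_pair: "a \<in> {0..1} \<Longrightarrow> b \<in> {0..1} \<Longrightarrow> unit_Inf {a, b} = min a b"
  by (simp add: unit_Inf_insert unit_Inf_empty)

text \<open>
  Binary minimum distributes over suprema because \<open>[0,1]\<close> is linearly ordered: either some member
  of \<open>S\<close> is at least \<open>c\<close> and both sides equal \<open>c\<close>, or taking minima with \<open>c\<close> does not change \<open>S\<close>.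
\<close>

lemma min_unit_Sup:
  assumes c: "c \<in> {0..1}" and S: "S \<subseteq> {0..1}"
  shows "min c (unit_Sup S) = unit_Sup (min c ` S)"
proof (rule antisym)
  have cS: "min c ` S \<subseteq> {0..1}" using c S by (auto simp: min_le_iff_disj)
  show "unit_Sup (min c ` S) \<le> min c (unit_Sup S)"
    using c S by (intro unit_Sup_least)
      (auto simp: min_le_iff_disj unit_Sup_nonneg intro: unit_Sup_upper)
  show "min c (unit_Sup S) \<le> unit_Sup (min c ` S)"
  proof (cases "\<exists>s\<in>S. c \<le> s")
    case True
    then have "c \<in> min c ` S" by (force simp: min_def)
    then show ?thesis using unit_Sup_upper[OF cS] by (auto simp: min_le_iff_disj)
  next
    case False
    then have "min c ` S = S" by (force simp: min_def image_iff)
    then show ?thesis by simp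
  qed
qed

section \<open>Systems generated by a separating valuation\<close>

definition pointwise_order :: "'x set \<Rightarrow> ('x \<Rightarrow> 'a \<Rightarrow> real) \<Rightarrow> 'a set \<Rightarrow> 'a gorder" where
  "pointwise_order X g A = \<lparr>carrier = A, eq = (=), le = (\<lambda>a b. \<forall>x\<in>X. g x a \<le> g x b)\<rparr>"

text \<open>
  A set of names for fuzzy subsets of \<open>X\<close>, distinct names denoting distinct fuzzy sets, that is closed
  under the operations of a fuzzy topology. Speaking of names instead of the fuzzy sets themselves
  allows the elements of the resulting frame to have any type.
\<close>

locale separating_valuation =
  fixes X :: "'x set" and g :: "'x \<Rightarrow> 'a \<Rightarrow> real" and A :: "'a set"
  assumes unit: "x \<in> X \<Longrightarrow> a \<in> A \<Longrightarrow> g x a \<in> {0..1}"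
    and separates: "a \<in> A \<Longrightarrow> b \<in> A \<Longrightarrow> (\<And>x. x \<in> X \<Longrightarrow> g x a = g x b) \<Longrightarrow> a = b"
    and top: "\<exists>t\<in>A. \<forall>x\<in>X. g x t = 1"
    and meets: "a \<in> A \<Longrightarrow> b \<in> A \<Longrightarrow> \<exists>m\<in>A. \<forall>x\<in>X. g x m = min (g x a) (g x b)"
    and joins: "S \<subseteq> A \<Longrightarrow> \<exists>j\<in>A. \<forall>x\<in>X. g x j = unit_Sup (g x ` S)"
begin

abbreviation L where "L \<equiv> pointwise_order X g A"

lemma carrier_L: "carrier L = A"
  by (simp add: pointwise_order_def)

lemma le_L: "a \<sqsubseteq>\<^bsub>L\<^esub> b \<longleftrightarrow> (\<forall>x\<in>X. g x a \<le> g x b)"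
  by (simp add: pointwise_order_def)

lemma partial_order_L: "partial_order L"
  by unfold_locales
    (auto simp: pointwise_order_def intro: order_trans intro!: separates, force intro: antisym)

lemma image_unit: "x \<in> X \<Longrightarrow> S \<subseteq> A \<Longrightarrow> g x ` S \<subseteq> {0..1}"
  using unit by blast

lemma pointwise_sup_is_lub:
  assumes S: "S \<subseteq> A" and j: "j \<in> A" "\<And>x. x \<in> X \<Longrightarrow> g x j = unit_Sup (g x ` S)"
  shows "is_lub L j S"
proof (rule least_UpperI)
  show "s \<sqsubseteq>\<^bsub>L\<^esub> j" if "s \<in> S" for s
    using that j(2) image_unit[OF _ S] by (simp add: le_L unit_Sup_upper)
  show "j \<sqsubseteq>\<^bsub>L\<^esub> u" if "u \<in> Upper L S" for u
  proof -
    have u: "u \<in> A" "\<And>s x. s \<in> S \<Longrightarrow> x \<in> X \<Longrightarrow> g x s \<le> g x u"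
      using that S by (auto simp: Upper_def carrier_L le_L)
    show ?thesis
      using u j unit[OF _ u(1)] by (auto simp: le_L intro!: unit_Sup_least)
  qed
qed (use S j in \<open>simp_all add: carrier_L\<close>)

lemma pointwise_inf_is_glb:
  assumes S: "S \<subseteq> A" and m: "m \<in> A" "\<And>x. x \<in> X \<Longrightarrow> g x m = unit_Inf (g x ` S)"
  shows "is_glb L m S"
proof (rule greatest_LowerI)
  show "m \<sqsubseteq>\<^bsub>L\<^esub> s" if "s \<in> S" for s
    using that m(2) image_unit[OF _ S] by (simp add: le_L unit_Inf_lower)
  show "u \<sqsubseteq>\<^bsub>L\<^esub> m" if "u \<in> Lower L S" for u
  proof -
    have u: "u \<in> A" "\<And>s x. s \<in> S \<Longrightarrow> x \<in> X \<Longrightarrow> g x u \<le> g x s"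
      using that S by (auto simp: Lower_def carrier_L le_L)
    show ?thesis
      using u m unit[OF _ u(1)] by (auto simp: le_L intro!: unit_Inf_greatest)
  qed
qed (use S m in \<open>simp_all add: carrier_L\<close>)

text \<open>
  A fuzzy topology is only required to be closed under the constant 1 and binary minima; the
  systems need all finite infima.
\<close>

lemma finite_meets: "finite S \<Longrightarrow> S \<subseteq> A \<Longrightarrow> \<exists>m\<in>A. \<forall>x\<in>X. g x m = unit_Inf (g x ` S)"
proof (induction rule: finite_induct)
  case empty
  then show ?case using top by (simp add: unit_Inf_empty)
next
  case (insert a S)
  then obtain m where m: "m \<in> A" "\<forall>x\<in>X. g x m = unit_Inf (g x ` S)" by auto
  obtain n where "n \<in> A" "\<forall>x\<in>X. g x n = min (g x a) (g x m)"
    using meets[of a m] insert.prems m by auto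
  moreover have "unit_Inf (g x ` insert a S) = min (g x a) (unit_Inf (g x ` S))" if "x \<in> X" for x
    using that unit image_unit[of x S] insert.prems by (simp add: unit_Inf_insert)
  ultimately show ?case using m by auto
qed

lemma sup_L:
  assumes "S \<subseteq> A"
  shows "\<Squnion>\<^bsub>L\<^esub>S \<in> A" "\<And>x. x \<in> X \<Longrightarrow> g x (\<Squnion>\<^bsub>L\<^esub>S) = unit_Sup (g x ` S)"
proof -
  obtain j where j: "j \<in> A" "\<forall>x\<in>X. g x j = unit_Sup (g x ` S)"
    using joins assms by blast
  have lub: "is_lub L j S" using assms j by (auto intro: pointwise_sup_is_lub)
  then have "is_lub L (\<Squnion>\<^bsub>L\<^esub>S) S" unfolding sup_def by (rule someI)
  then have "\<Squnion>\<^bsub>L\<^esub>S = j" using lub partial_order.least_unique[OF partial_order_L] by blast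
  then show "\<Squnion>\<^bsub>L\<^esub>S \<in> A" "\<And>x. x \<in> X \<Longrightarrow> g x (\<Squnion>\<^bsub>L\<^esub>S) = unit_Sup (g x ` S)"
    using j by auto
qed

lemma inf_L:
  assumes "finite S" "S \<subseteq> A"
  shows "\<Sqinter>\<^bsub>L\<^esub>S \<in> A" "\<And>x. x \<in> X \<Longrightarrow> g x (\<Sqinter>\<^bsub>L\<^esub>S) = unit_Inf (g x ` S)"
proof -
  obtain m where m: "m \<in> A" "\<forall>x\<in>X. g x m = unit_Inf (g x ` S)"
    using finite_meets assms by blast
  have glb: "is_glb L m S" using assms m by (auto intro: pointwise_inf_is_glb)
  then have "is_glb L (\<Sqinter>\<^bsub>L\<^esub>S) S" unfolding inf_def by (rule someI)
  then have "\<Sqinter>\<^bsub>L\<^esub>S = m" using glb partial_order.greatest_unique[OF partial_order_L] by blast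
  then show "\<Sqinter>\<^bsub>L\<^esub>S \<in> A" "\<And>x. x \<in> X \<Longrightarrow> g x (\<Sqinter>\<^bsub>L\<^esub>S) = unit_Inf (g x ` S)"
    using m by auto
qed

lemma meet_L:
  assumes "a \<in> A" "b \<in> A"
  shows "a \<sqinter>\<^bsub>L\<^esub> b \<in> A" "\<And>x. x \<in> X \<Longrightarrow> g x (a \<sqinter>\<^bsub>L\<^esub> b) = min (g x a) (g x b)"
  using inf_L[of "{a, b}"] assms unit unfolding meet_def by (simp_all add: unit_Inf_pair)

text \<open>
  Distributivity is inherited from \<open>[0,1]\<close>: by separation the two sides need only be compared at
  each point, where meets and joins are minima and suprema of real numbers.
\<close>

lemma frame_L: "frame L"
proof -
  interpret partial_order L by (rule partial_order_L)
  show ?thesis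
  proof (unfold_locales, unfold carrier_L)
    show "\<exists>s. is_lub L s S" if "S \<subseteq> A" for S
      using that sup_L by (blast intro: pointwise_sup_is_lub)
    show "\<exists>s. is_glb L s S" if "finite S" "S \<subseteq> A" for S
      using that inf_L by (blast intro: pointwise_inf_is_glb)
    fix a S assume a: "a \<in> A" and S: "S \<subseteq> A"
    have aS: "(\<lambda>s. a \<sqinter>\<^bsub>L\<^esub> s) ` S \<subseteq> A" using a S meet_L(1) by blast
    show "a \<sqinter>\<^bsub>L\<^esub> \<Squnion>\<^bsub>L\<^esub>S = \<Squnion>\<^bsub>L\<^esub>((\<lambda>s. a \<sqinter>\<^bsub>L\<^esub> s) ` S)"
    proof (rule separates)
      fix x assume x: "x \<in> X"
      have "g x ` (\<lambda>s. a \<sqinter>\<^bsub>L\<^esub> s) ` S = min (g x a) ` g x ` S"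
        using a S x meet_L(2) by (force simp: image_image intro!: image_cong)
      then show "g x (a \<sqinter>\<^bsub>L\<^esub> \<Squnion>\<^bsub>L\<^esub>S) = g x (\<Squnion>\<^bsub>L\<^esub>((\<lambda>s. a \<sqinter>\<^bsub>L\<^esub> s) ` S))"
        using a S aS x min_unit_Sup[OF unit[OF x a] image_unit[OF x S]]
        by (simp add: meet_L sup_L)
    qed (use a S aS in \<open>simp_all add: meet_L sup_L\<close>)
  qed
qed

lemma spatial_system:
  assumes "X \<noteq> {}"
  defines "D \<equiv> \<lparr>sys_points = X, gr = g, sys_frame = L\<rparr>"
  shows "fuzzy_topological_system D" "spatial D"
  unfolding D_def fuzzy_topological_system_def spatial_def
  using assms(1) frame_L unit sup_L inf_L separates
  by (auto simp: carrier_L Let_def)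

end

section \<open>Fuzzy topological systems and their morphisms\<close>

lemma (in frame) sup_closed: "S \<subseteq> carrier L \<Longrightarrow> \<Squnion>S \<in> carrier L"
  using someI_ex[OF joins_exist, of S] unfolding sup_def
  by (auto dest: least_closed)

lemma (in frame) inf_closed: "finite S \<Longrightarrow> S \<subseteq> carrier L \<Longrightarrow> \<Sqinter>S \<in> carrier L"
  using someI_ex[OF finite_meets_exist, of S] unfolding inf_def
  by (auto dest: greatest_closed)

lemma
  assumes "fuzzy_topological_system D"
  shows system_frame: "frame (sys_frame D)"
    and gr_unit: "x \<in> sys_points D \<Longrightarrow> a \<in> carrier (sys_frame D) \<Longrightarrow> gr D x a \<in> {0..1}"
    and gr_inf: "x \<in> sys_points D \<Longrightarrow> finite S \<Longrightarrow> S \<subseteq> carrier (sys_frame D)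
      \<Longrightarrow> gr D x (\<Sqinter>\<^bsub>sys_frame D\<^esub>S) = unit_Inf (gr D x ` S)"
    and gr_sup: "x \<in> sys_points D \<Longrightarrow> S \<subseteq> carrier (sys_frame D)
      \<Longrightarrow> gr D x (\<Squnion>\<^bsub>sys_frame D\<^esub>S) = unit_Sup (gr D x ` S)"
  using assms unfolding fuzzy_topological_system_def Let_def by auto

text \<open>
  Into the frame of a spatial system, preservation of joins and meets is automatic: \<open>h (\<Squnion>S)\<close> and \<open>\<Squnion>(h ` S)\<close> take the
  same value at every point, namely the supremum of the values of \<open>S\<close> at the image point, and
  elements with equal values coincide.
\<close>

lemma frame_hom_if_gr_compatible:
  assumes D: "fuzzy_topological_system D" "spatial D" and E: "fuzzy_topological_system E"
    and f: "f \<in> sys_points D \<rightarrow> sys_points E"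
    and h: "h \<in> carrier (sys_frame E) \<rightarrow> carrier (sys_frame D)"
    and gr: "\<And>x b. x \<in> sys_points D \<Longrightarrow> b \<in> carrier (sys_frame E) \<Longrightarrow> gr D x (h b) = gr E (f x) b"
  shows "frame_hom (sys_frame E) (sys_frame D) h"
proof -
  interpret D: frame "sys_frame D" using D(1) by (rule system_frame)
  interpret E: frame "sys_frame E" using E by (rule system_frame)
  have eqI: "a = b" if "a \<in> carrier (sys_frame D)" "b \<in> carrier (sys_frame D)"
    "\<And>x. x \<in> sys_points D \<Longrightarrow> gr D x a = gr D x b" for a b
    using D(2) that unfolding spatial_def by blast
  have img: "h ` S \<subseteq> carrier (sys_frame D)"
    "x \<in> sys_points D \<Longrightarrow> gr D x ` h ` S = gr E (f x) ` S"
    if "S \<subseteq> carrier (sys_frame E)" for S x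
    using h that gr by (auto simp: image_image subset_iff intro!: image_cong)
  have "h (\<Squnion>\<^bsub>sys_frame E\<^esub>S) = \<Squnion>\<^bsub>sys_frame D\<^esub>(h ` S)" if S: "S \<subseteq> carrier (sys_frame E)" for S
  proof (rule eqI)
    show "gr D x (h (\<Squnion>\<^bsub>sys_frame E\<^esub>S)) = gr D x (\<Squnion>\<^bsub>sys_frame D\<^esub>(h ` S))" if "x \<in> sys_points D" for x
      using f that S img[OF S] by (simp add: gr gr_sup[OF D(1)] gr_sup[OF E] E.sup_closed Pi_iff)
  qed (use h S img[OF S] D.sup_closed E.sup_closed in auto)
  moreover have "h (\<Sqinter>\<^bsub>sys_frame E\<^esub>S) = \<Sqinter>\<^bsub>sys_frame D\<^esub>(h ` S)"
    if S: "S \<subseteq> carrier (sys_frame E)" "finite S" for S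
  proof (rule eqI)
    show "gr D x (h (\<Sqinter>\<^bsub>sys_frame E\<^esub>S)) = gr D x (\<Sqinter>\<^bsub>sys_frame D\<^esub>(h ` S))" if "x \<in> sys_points D" for x
      using f that S img[OF S(1)]
      by (simp add: gr gr_inf[OF D(1)] gr_inf[OF E] E.inf_closed Pi_iff)
  qed (use h S img[OF S(1)] D.inf_closed E.inf_closed in auto)
  ultimately show ?thesis using h unfolding frame_hom_def by blast
qed

text \<open>
  This reduces recognizing a morphism whose source is spatial, in particular closure under
  composition, to a computation with \<open>gr\<close>.
\<close>

lemma system_morphism_iff:
  assumes "fuzzy_topological_system D" "spatial D" "fuzzy_topological_system E"
  shows "system_morphism D E f \<longleftrightarrow>
    fst f \<in> sys_points D \<rightarrow>\<^sub>E sys_points E \<and>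
    snd f \<in> carrier (sys_frame E) \<rightarrow>\<^sub>E carrier (sys_frame D) \<and>
    (\<forall>x\<in>sys_points D. \<forall>b\<in>carrier (sys_frame E). gr D x (snd f b) = gr E (fst f x) b)"
  unfolding system_morphism_def
  using frame_hom_if_gr_compatible[OF assms, of "fst f" "snd f"] by (auto simp: PiE_def)

lemma system_morphism_eqI:
  assumes D: "spatial D" and f: "system_morphism D E f" and h: "system_morphism D E h"
    and eq: "fst f = fst h"
  shows "f = h"
proof (rule prod_eqI[OF eq])
  have in_PiE: "snd f \<in> carrier (sys_frame E) \<rightarrow>\<^sub>E carrier (sys_frame D)"
    "snd h \<in> carrier (sys_frame E) \<rightarrow>\<^sub>E carrier (sys_frame D)"
    using f h unfolding system_morphism_def by auto
  show "snd f = snd h"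
  proof (rule PiE_ext[OF in_PiE])
    fix b assume b: "b \<in> carrier (sys_frame E)"
    then have "gr D x (snd f b) = gr D x (snd h b)" if "x \<in> sys_points D" for x
      using that f h eq unfolding system_morphism_def by simp
    then show "snd f b = snd h b"
      using D PiE_mem[OF in_PiE(1) b] PiE_mem[OF in_PiE(2) b] unfolding spatial_def by blast
  qed
qed

section \<open>The two categories\<close>

lemma compose_restrict_id:
  assumes "f \<in> X \<rightarrow>\<^sub>E Y"
  shows "compose X f (\<lambda>x\<in>X. x) = f" "compose X (\<lambda>y\<in>Y. y) f = f"
  using assms by (auto simp: PiE_def intro!: compose_Id Id_compose)

lemma compose_PiE:
  assumes "f \<in> X \<rightarrow>\<^sub>E Y" "h \<in> Y \<rightarrow>\<^sub>E Z"
  shows "compose X h f \<in> X \<rightarrow>\<^sub>E Z"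
  using assms funcset_compose[of f X Y h Z] by (simp add: PiE_def)

lemma category_fuzzy_Top:
  fixes PS :: "'x set set"
  shows "category (fuzzy_Top PS)"
proof (rule category.intro, unfold fuzzy_Top_def cat.simps mem_Collect_eq)
  show "fuzzy_continuous T T (\<lambda>x\<in>space_points T. x)"
    if T: "space_points T \<in> PS \<and> fuzzy_topological_space T" for T
  proof -
    have "fuzzy_opens T \<subseteq> space_points T \<rightarrow>\<^sub>E {0..1}"
      using T unfolding fuzzy_topological_space_def Let_def by blast
    then have "compose (space_points T) B (\<lambda>x\<in>space_points T. x) = B" if "B \<in> fuzzy_opens T" for B
      using that by (intro compose_restrict_id(1)) (rule subsetD)
    then show ?thesis by (simp add: fuzzy_continuous_def)
  qed
next
  fix R S T :: "'x fuzzy_space" and f h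
  assume f: "fuzzy_continuous R S f" and h: "fuzzy_continuous S T h"
  have "compose (space_points R) B (compose (space_points R) h f)
      = compose (space_points R) (compose (space_points S) B h) f" for B :: "'x \<Rightarrow> real"
    using f by (intro compose_assoc) (auto simp: fuzzy_continuous_def)
  moreover have "compose (space_points R) h f \<in> space_points R \<rightarrow>\<^sub>E space_points T"
    using f h by (intro compose_PiE[of f _ "space_points S"]) (simp_all add: fuzzy_continuous_def)
  ultimately show "fuzzy_continuous R T (compose (space_points R) h f)"
    using f h by (simp add: fuzzy_continuous_def)
next
  fix R S T U f h k
  assume f: "fuzzy_continuous R S f"
  show "compose (space_points R) k (compose (space_points R) h f)
      = compose (space_points R) (compose (space_points S) k h) f"
    using f by (intro compose_assoc) (auto simp: fuzzy_continuous_def)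
qed (auto simp: fuzzy_continuous_def intro: compose_restrict_id)

abbreviation spatial_systems where
  "spatial_systems PS FS \<equiv> full_subcategory (fuzzy_TopSys PS FS) spatial"

lemma obj_spatial_systems: "D \<in> obj (spatial_systems PS FS) \<longleftrightarrow>
  sys_points D \<in> PS \<and> carrier (sys_frame D) \<in> FS \<and> fuzzy_topological_system D \<and> spatial D"
  by (simp add: full_subcategory_def fuzzy_TopSys_def)

lemma category_spatial_systems: "category (spatial_systems PS FS)"
proof (rule category.intro, unfold obj_spatial_systems,
    unfold full_subcategory_def fuzzy_TopSys_def cat.simps mem_Collect_eq)
  fix D E K f h
  assume sys: "sys_points D \<in> PS \<and> carrier (sys_frame D) \<in> FS \<and>
      fuzzy_topological_system D \<and> spatial D"
    "sys_points K \<in> PS \<and> carrier (sys_frame K) \<in> FS \<and>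
      fuzzy_topological_system K \<and> spatial K"
    and f: "system_morphism D E f" and h: "system_morphism E K h"
  have "fst f \<in> sys_points D \<rightarrow>\<^sub>E sys_points E" "fst h \<in> sys_points E \<rightarrow>\<^sub>E sys_points K"
    "snd f \<in> carrier (sys_frame E) \<rightarrow>\<^sub>E carrier (sys_frame D)"
    "snd h \<in> carrier (sys_frame K) \<rightarrow>\<^sub>E carrier (sys_frame E)"
    using f h by (simp_all add: system_morphism_def)
  moreover from this have "gr D x (snd f (snd h b)) = gr K (fst h (fst f x)) b"
    if "x \<in> sys_points D" "b \<in> carrier (sys_frame K)" for x b
    using f h that by (simp add: system_morphism_def PiE_iff)
  ultimately show "system_morphism D K (compose (sys_points D) (fst h) (fst f),
      compose (carrier (sys_frame K)) (snd f) (snd h))"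
    using sys by (simp add: system_morphism_iff compose_PiE compose_eq)
next
  fix D E K M f h k
  assume "system_morphism D E f" "system_morphism E K h" "system_morphism K M k"
  then have "fst f \<in> sys_points D \<rightarrow> sys_points E"
    "snd k \<in> carrier (sys_frame M) \<rightarrow> carrier (sys_frame K)"
    by (auto simp: system_morphism_def)
  then show "(compose (sys_points D) (fst k)
        (fst (compose (sys_points D) (fst h) (fst f),
          compose (carrier (sys_frame K)) (snd f) (snd h))),
      compose (carrier (sys_frame M))
        (snd (compose (sys_points D) (fst h) (fst f),
          compose (carrier (sys_frame K)) (snd f) (snd h))) (snd k))
    = (compose (sys_points D)
        (fst (compose (sys_points E) (fst k) (fst h),
          compose (carrier (sys_frame M)) (snd h) (snd k))) (fst f),
      compose (carrier (sys_frame M)) (snd f)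
        (snd (compose (sys_points E) (fst k) (fst h),
          compose (carrier (sys_frame M)) (snd h) (snd k))))"
    by (simp add: compose_assoc)
next
  fix D :: "('a, 'b) fuzzy_system"
  assume "sys_points D \<in> PS \<and> carrier (sys_frame D) \<in> FS \<and>
      fuzzy_topological_system D \<and> spatial D"
  then show "system_morphism D D (\<lambda>x\<in>sys_points D. x, \<lambda>a\<in>carrier (sys_frame D). a)"
    by (simp add: system_morphism_iff)
qed (auto simp: system_morphism_def prod_eq_iff intro: compose_restrict_id)

section \<open>The comparison functor\<close>

definition extent :: "('x, 'a) fuzzy_system \<Rightarrow> 'a \<Rightarrow> 'x \<Rightarrow> real" where
  "extent D a = (\<lambda>x\<in>sys_points D. gr D x a)"

definition extent_space :: "('x, 'a) fuzzy_system \<Rightarrow> 'x fuzzy_space" where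
  "extent_space D = \<lparr>space_points = sys_points D,
     fuzzy_opens = extent D ` carrier (sys_frame D)\<rparr>"

definition extent_functor ::
  "(('x, 'a) fuzzy_system, ('x \<Rightarrow> 'x) \<times> ('a \<Rightarrow> 'a), 'x fuzzy_space, 'x \<Rightarrow> 'x) fctr" where
  "extent_functor = \<lparr>on_obj = extent_space, on_hom = (\<lambda>D E f. fst f)\<rparr>"

lemma extent_space_topological:
  assumes D: "fuzzy_topological_system D"
  shows "fuzzy_topological_space (extent_space D)"
proof -
  interpret frame "sys_frame D" using D by (rule system_frame)
  let ?X = "sys_points D" and ?A = "carrier (sys_frame D)"
  have inf: "(\<lambda>x\<in>?X. unit_Inf (gr D x ` S)) \<in> extent D ` ?A" if "finite S" "S \<subseteq> ?A" for S
    using that gr_inf[OF D] inf_closed[of S]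
    by (intro image_eqI[of _ _ "\<Sqinter>\<^bsub>sys_frame D\<^esub>S"]) (auto simp: extent_def)
  have sup: "(\<lambda>x\<in>?X. unit_Sup (gr D x ` S)) \<in> extent D ` ?A" if "S \<subseteq> ?A" for S
    using that gr_sup[OF D] sup_closed[of S]
    by (intro image_eqI[of _ _ "\<Squnion>\<^bsub>sys_frame D\<^esub>S"]) (auto simp: extent_def)
  have "(\<lambda>x\<in>?X. unit_Sup ((\<lambda>B. B x) ` \<T>)) \<in> extent D ` ?A" if \<T>: "\<T> \<subseteq> extent D ` ?A" for \<T>
  proof -
    obtain S where S: "S \<subseteq> ?A" "\<T> = extent D ` S" using \<T> by (meson subset_imageE)
    have "(\<lambda>B. B x) ` \<T> = gr D x ` S" if "x \<in> ?X" for x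
      using that S by (simp add: image_image extent_def)
    then have "(\<lambda>x\<in>?X. unit_Sup ((\<lambda>B. B x) ` \<T>)) = (\<lambda>x\<in>?X. unit_Sup (gr D x ` S))"
      by (intro restrict_ext) simp
    then show ?thesis using sup[OF S(1)] by simp
  qed
  moreover have "(\<lambda>x\<in>?X. min (extent D a x) (extent D b x)) \<in> extent D ` ?A"
    if "a \<in> ?A" "b \<in> ?A" for a b
  proof -
    have "(\<lambda>x\<in>?X. min (extent D a x) (extent D b x)) = (\<lambda>x\<in>?X. unit_Inf (gr D x ` {a, b}))"
      using that gr_unit[OF D] by (intro restrict_ext) (simp add: extent_def unit_Inf_pair)
    then show ?thesis using inf[of "{a, b}"] that by simp
  qed
  moreover have "extent D ` ?A \<subseteq> ?X \<rightarrow>\<^sub>E {0..1}"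
    using gr_unit[OF D] by (auto simp: extent_def)
  ultimately show ?thesis
    using inf[of "{}"] sup[of "{}"]
    by (auto simp: fuzzy_topological_space_def extent_space_def Let_def unit_Inf_empty unit_Sup_empty)
qed

lemma compose_extent:
  assumes "f \<in> sys_points D \<rightarrow> sys_points E"
    and "\<And>x. x \<in> sys_points D \<Longrightarrow> gr D x a = gr E (f x) b"
  shows "compose (sys_points D) (extent E b) f = extent D a"
  using assms by (auto simp: compose_def extent_def fun_eq_iff Pi_iff)

lemma fst_system_morphism_continuous:
  assumes "system_morphism D E f"
  shows "fuzzy_continuous (extent_space D) (extent_space E) (fst f)"
proof -
  have f: "fst f \<in> sys_points D \<rightarrow>\<^sub>E sys_points E"
    "snd f \<in> carrier (sys_frame E) \<rightarrow>\<^sub>E carrier (sys_frame D)"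
    "\<And>x b. x \<in> sys_points D \<Longrightarrow> b \<in> carrier (sys_frame E) \<Longrightarrow> gr D x (snd f b) = gr E (fst f x) b"
    using assms by (auto simp: system_morphism_def)
  have "compose (sys_points D) (extent E b) (fst f) = extent D (snd f b)"
    if "b \<in> carrier (sys_frame E)" for b
    using f that by (intro compose_extent) auto
  then show ?thesis using f by (auto simp: fuzzy_continuous_def extent_space_def PiE_mem)
qed

text \<open>
  Continuity says that the pullback along \<open>f\<close> of the extent of \<open>b\<close> is the extent of some element;
  choosing one such element for each \<open>b\<close> gives the frame component.
\<close>

lemma continuous_lifts_to_system_morphism:
  assumes D: "fuzzy_topological_system D" "spatial D" and E: "fuzzy_topological_system E"
    and f: "fuzzy_continuous (extent_space D) (extent_space E) f"
  shows "\<exists>h. system_morphism D E (f, h)"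
proof -
  have pts: "f \<in> sys_points D \<rightarrow>\<^sub>E sys_points E"
    using f by (simp add: fuzzy_continuous_def extent_space_def)
  have "\<exists>a\<in>carrier (sys_frame D). compose (sys_points D) (extent E b) f = extent D a"
    if "b \<in> carrier (sys_frame E)" for b
    using f that unfolding fuzzy_continuous_def extent_space_def by auto
  then obtain h where h: "\<And>b. b \<in> carrier (sys_frame E) \<Longrightarrow>
      h b \<in> carrier (sys_frame D) \<and> compose (sys_points D) (extent E b) f = extent D (h b)"
    by metis
  have "gr D x (h b) = gr E (f x) b" if "x \<in> sys_points D" "b \<in> carrier (sys_frame E)" for x b
    using fun_cong[OF conjunct2[OF h[OF that(2)]], of x] that PiE_mem[OF pts that(1)]
    by (simp add: compose_def extent_def)
  then have "system_morphism D E (f, restrict h (carrier (sys_frame E)))"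
    using h pts by (simp add: system_morphism_iff[OF D E])
  then show ?thesis by blast
qed

lemma extent_functor: "cat_functor (spatial_systems PS FS) (fuzzy_Top PS) extent_functor"
proof -
  interpret C: category "spatial_systems PS FS" by (rule category_spatial_systems)
  interpret D: category "fuzzy_Top PS" by (rule category_fuzzy_Top)
  show ?thesis
    by unfold_locales
      (auto simp: extent_functor_def obj_spatial_systems full_subcategory_def fuzzy_TopSys_def
        fuzzy_Top_def extent_space_topological fst_system_morphism_continuous,
       simp_all add: extent_space_def)
qed

lemma extent_functor_full_faithful:
  assumes "D \<in> obj (spatial_systems PS FS)" "E \<in> obj (spatial_systems PS FS)"
  shows "bij_betw (on_hom extent_functor D E) (hom (spatial_systems PS FS) D E)
    (hom (fuzzy_Top PS) (on_obj extent_functor D) (on_obj extent_functor E))"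
  unfolding bij_betw_def
proof
  have hom: "hom (spatial_systems PS FS) D E = {f. system_morphism D E f}"
    by (simp add: full_subcategory_def fuzzy_TopSys_def)
  have *: "fuzzy_topological_system D" "spatial D" "fuzzy_topological_system E"
    using assms by (auto simp: obj_spatial_systems)
  show "inj_on (on_hom extent_functor D E) (hom (spatial_systems PS FS) D E)"
    using system_morphism_eqI[OF *(2)] by (intro inj_onI) (simp add: extent_functor_def hom)
  show "on_hom extent_functor D E ` hom (spatial_systems PS FS) D E
      = hom (fuzzy_Top PS) (on_obj extent_functor D) (on_obj extent_functor E)"
  proof (rule antisym)
    show "hom (fuzzy_Top PS) (on_obj extent_functor D) (on_obj extent_functor E)
        \<subseteq> on_hom extent_functor D E ` hom (spatial_systems PS FS) D E"
    proof
      fix f assume "f \<in> hom (fuzzy_Top PS) (on_obj extent_functor D) (on_obj extent_functor E)"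
      then obtain h where "system_morphism D E (f, h)"
        using continuous_lifts_to_system_morphism[OF *] by (auto simp: extent_functor_def fuzzy_Top_def)
      then show "f \<in> on_hom extent_functor D E ` hom (spatial_systems PS FS) D E"
        by (intro image_eqI[of _ _ "(f, h)"]) (simp_all add: extent_functor_def hom)
    qed
  qed (use assms cat_functor.on_hom_in_hom[OF extent_functor] in blast)
qed

text \<open>
  The opens themselves, ordered pointwise, would be a frame of the right shape, but the carrier of
  the frame is prescribed up to bijection only, so \<open>\<phi>\<close> is used to name each open by an element
  of \<open>A\<close>.
\<close>

lemma space_is_extent_space:
  assumes T: "fuzzy_topological_space T" "space_points T \<noteq> {}"
    and A: "fuzzy_opens T \<approx> A"
  shows "\<exists>D. fuzzy_topological_system D \<and> spatial D \<and> carrier (sys_frame D) = A \<and>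
    extent_space D = T"
proof -
  let ?X = "space_points T" and ?\<tau> = "fuzzy_opens T"
  have opens: "?\<tau> \<subseteq> ?X \<rightarrow>\<^sub>E {0..1}" and one: "(\<lambda>x\<in>?X. 1) \<in> ?\<tau>"
    and sup: "\<And>S. S \<subseteq> ?\<tau> \<Longrightarrow> (\<lambda>x\<in>?X. unit_Sup ((\<lambda>B. B x) ` S)) \<in> ?\<tau>"
    and min: "\<And>B C. B \<in> ?\<tau> \<Longrightarrow> C \<in> ?\<tau> \<Longrightarrow> (\<lambda>x\<in>?X. min (B x) (C x)) \<in> ?\<tau>"
    using T(1) unfolding fuzzy_topological_space_def Let_def by blast+
  obtain \<phi> where \<phi>: "bij_betw \<phi> A ?\<tau>"
    using A eqpoll_sym unfolding eqpoll_def by blast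
  then have \<phi>_img: "\<phi> ` A = ?\<tau>" and \<phi>_inj: "inj_on \<phi> A" by (auto simp: bij_betw_def)
  have \<phi>_in: "\<phi> a \<in> ?\<tau>" if "a \<in> A" for a using that \<phi>_img by blast
  interpret separating_valuation ?X "\<lambda>x a. \<phi> a x" A
  proof
    show "\<phi> a x \<in> {0..1}" if "x \<in> ?X" "a \<in> A" for x a
      using that \<phi>_in opens by (meson PiE_mem subsetD)
    show "a = b" if "a \<in> A" "b \<in> A" "\<And>x. x \<in> ?X \<Longrightarrow> \<phi> a x = \<phi> b x" for a b
    proof (rule inj_onD[OF \<phi>_inj _ that(1,2)])
      have "\<phi> a \<in> ?X \<rightarrow>\<^sub>E {0..1}" "\<phi> b \<in> ?X \<rightarrow>\<^sub>E {0..1}" using that(1,2) \<phi>_in opens by blast+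
      then show "\<phi> a = \<phi> b" by (rule PiE_ext) (rule that(3))
    qed
    \<comment> \<open>Each closure property of the topology becomes one of the names, since \<open>\<phi>\<close> is onto.\<close>
    have val: "\<exists>a\<in>A. \<forall>x\<in>?X. \<phi> a x = u x" if "(\<lambda>x\<in>?X. u x) \<in> ?\<tau>" for u
    proof -
      from that obtain a where a: "a \<in> A" and "(\<lambda>x\<in>?X. u x) = \<phi> a"
        unfolding \<phi>_img[symmetric] by (rule imageE)
      then have "\<phi> a x = u x" if "x \<in> ?X" for x
        using that by (metis restrict_apply')
      with a show ?thesis by blast
    qed
    show "\<exists>t\<in>A. \<forall>x\<in>?X. \<phi> t x = 1" by (rule val[OF one])
    show "\<exists>m\<in>A. \<forall>x\<in>?X. \<phi> m x = min (\<phi> a x) (\<phi> b x)" if "a \<in> A" "b \<in> A" for a b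
      by (rule val[OF min[OF \<phi>_in[OF that(1)] \<phi>_in[OF that(2)]]])
    show "\<exists>j\<in>A. \<forall>x\<in>?X. \<phi> j x = unit_Sup ((\<lambda>a. \<phi> a x) ` S)" if "S \<subseteq> A" for S
      using val[OF sup[of "\<phi> ` S"]] that \<phi>_img by (auto simp: image_image)
  qed
  let ?D = "\<lparr>sys_points = ?X, gr = \<lambda>x a. \<phi> a x, sys_frame = L\<rparr>"
  have "extent ?D a = \<phi> a" if "a \<in> A" for a
    using \<phi>_in[OF that] opens
    by (intro extensionalityI[of _ ?X]) (auto simp: extent_def PiE_def)
  then have "extent ?D ` A = ?\<tau>" using \<phi>_img by simp
  then have "extent_space ?D = T" by (simp add: extent_space_def carrier_L)
  then show ?thesis using spatial_system[OF T(2)] carrier_L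
    by (intro exI[of _ ?D]) simp
qed

theorem theorem2p4p1:
  fixes PS :: "'x set set" and FS :: "'a set set"
  assumes nonempty: "{} \<notin> PS"
    and universe: "\<And>X T. X \<in> PS \<Longrightarrow> T \<subseteq> X \<rightarrow>\<^sub>E {0..1::real} \<Longrightarrow> \<exists>A\<in>FS. T \<approx> A"
  shows "equivalent_categories (full_subcategory (fuzzy_TopSys PS FS) spatial) (fuzzy_Top PS)"
proof (rule full_faithful_surjective_equivalence[OF extent_functor extent_functor_full_faithful])
  show "on_obj extent_functor ` obj (spatial_systems PS FS) = obj (fuzzy_Top PS)"
  proof
    show "on_obj extent_functor ` obj (spatial_systems PS FS) \<subseteq> obj (fuzzy_Top PS)"
      using cat_functor.on_obj_in_obj[OF extent_functor] by blast
    show "obj (fuzzy_Top PS) \<subseteq> on_obj extent_functor ` obj (spatial_systems PS FS)"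
    proof
      fix T assume "T \<in> obj (fuzzy_Top PS)"
      then have T: "space_points T \<in> PS" "fuzzy_topological_space T"
        by (auto simp: fuzzy_Top_def)
      then have "fuzzy_opens T \<subseteq> space_points T \<rightarrow>\<^sub>E {0..1}"
        by (simp add: fuzzy_topological_space_def Let_def)
      then obtain A where A: "A \<in> FS" "fuzzy_opens T \<approx> A" using universe T(1) by blast
      obtain D where D: "fuzzy_topological_system D" "spatial D" "carrier (sys_frame D) = A"
        "extent_space D = T"
        using space_is_extent_space[OF T(2) _ A(2)] T(1) nonempty by metis
      then have "sys_points D \<in> PS" using T(1) by (auto simp: extent_space_def)
      then show "T \<in> on_obj extent_functor ` obj (spatial_systems PS FS)"
        using D A(1) by (auto simp: extent_functor_def obj_spatial_systems intro!: image_eqI[of _ _ D])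
    qed
  qed
qed

end
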